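(* Let $y(t;\mu)\in\mathbb{R}^d$ denote the optimal trajectory, at time $t\in[0,T]$ and parameter $\mu\in\mathbb{R}^M$, of the parameter-dependent optimal control problem described in the context. Consider $t$ as a uniformly distributed random variable on $[0,T]$ and $\mu$ as a random vector with density $\pi$, so that $y=y(t;\mu)$ is a random vector in $\mathbb{R}^d$ with components $y_1,\dots,y_d$. Consider $N$ i.i.d. realizations $y^{(i)}:=y(t_i;\mu_i)$, $i=1,\dots,N$, of the optimal trajectories, independent of $y(t;\mu)$. Assume that $\sqrt{\mathrm{Var}[y_jy_k]}\le C<\infty$ for any $j,k=1,\dots,d$. Let $$ G=\frac1N\sum_{i=1}^N y(t_i;\mu_i)\,y(t_i;\mu_i)^\top,\qquad G^*=\mathbb{E}[yy^\top], $$ and let $U^\ell\in\mathbb{R}^{d\times\ell}$ be an orthonormal matrix (i.e. with orthonormal columns) of $\ell$ leading eigenvectors of $G$. Then $$ \mathbb{E}\big[\|y(t;\mu)-U^\ell(U^\ell)^\top y(t;\mu)\|_2^2\big]\;\le\;\sum_{j=\ell+1}^d\lambda_j^*+2d\ell\,\frac{C}{\sqrt N}\;\le\;\sum_{j=\ell+1}^d\lambda_j+(d+\ell)d\,\frac{C}{\sqrt N}, $$ where $\lambda_j^*$ are the eigenvalues of $G^*$ sorted in descending order, and $\lambda_j$ are the eigenvalues of $G$ sorted in descending order.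
   Context: Setting. $\mu=(\mu_1,\dots,\mu_M)$ is a random vector in $\mathbb{R}^M$ with product density $\pi(\mu)=\pi(\mu_1)\cdots\pi(\mu_M)$. For each $\mu$, consider the control system $$\tfrac{d}{dt}y(t;\mu)=f(y(t;\mu),u(t;\mu),\mu),\quad t\in(0,T],\qquad y(0;\mu)=x(\mu)\in\mathbb{R}^d,$$ with controls $u\in\mathcal U=L^\infty([0,T]\times\mathbb{R}^M;U_{ad})$, $U_{ad}\subseteq\mathbb{R}^m$, and the problem of minimizing over $u\in\mathcal U$ the cost $$J_T(u;x,\mu)=\int_0^T L(y(t;\mu),u(t;\mu))\,dt,$$ where $L:\mathbb{R}^d\times\mathbb{R}^m\to\mathbb{R}$ is a running cost. The optimal trajectory $y(\cdot;\mu)$ is the state trajectory generated by an optimal control for the given $\mu$. Conventions. $\|\cdot\|_2$ is the Euclidean norm. "Leading eigenvectors" of $G$ are those belonging to its largest eigenvalues. The expectation on the left-hand side of the estimate is the total expectation, over both $y(t;\mu)$ and the samples $y^{(1)},\dots,y^{(N)}$ that determine $G$ and $U^\ell$.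
   Formalization: The sum of the eigenvalues λ_j of the random matrix G in the last bound is replaced by its expectation, because the inequality fails for individual sample outcomes (e.g. y = e_1 or e_2 with probability 1/2, all samples e_1, N > 4). *)

theory Defs
  imports
    "HOL-Analysis.Analysis"
    "HOL-Probability.Probability"
    "HOL-Computational_Algebra.Polynomial"
begin

text \<open>
  A control is a function of time and of the parameter. Elements of
  \<open>L\<^sup>\<infinity>([0,T] \<times> \<real>\<^sup>M; U)\<close> are represented by bounded Borel functions taking values in
  \<open>U\<close> everywhere: the control problem is posed for each single parameter, whose slice is a
  null set of \<open>[0,T] \<times> \<real>\<^sup>M\<close>, so constraints that hold only almost everywhere on the product
  would not constrain it.
\<close>

definition admissible_controls ::
    "real \<Rightarrow> (real^'m) set \<Rightarrow> (real \<Rightarrow> real^'p \<Rightarrow> real^'m) set" where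
  "admissible_controls T Uad =
     {u. (\<lambda>(t, \<mu>). u t \<mu>) \<in> borel_measurable (restrict_space borel ({0..T} \<times> UNIV)) \<and>
         bounded ((\<lambda>(t, \<mu>). u t \<mu>) ` ({0..T} \<times> UNIV)) \<and>
         (\<forall>t\<in>{0..T}. \<forall>\<mu>. u t \<mu> \<in> Uad)}"

text \<open>
  Controls are merely measurable in time, so the state equation is understood in the sense of
  Caratheodory, i.e. in integrated form.
\<close>

definition state_trajectory ::
    "real \<Rightarrow> (real^'d \<Rightarrow> real^'m \<Rightarrow> real^'p \<Rightarrow> real^'d) \<Rightarrow> (real^'p \<Rightarrow> real^'d) \<Rightarrow>
     (real \<Rightarrow> real^'p \<Rightarrow> real^'m) \<Rightarrow> real^'p \<Rightarrow> (real \<Rightarrow> real^'d) \<Rightarrow> bool" where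
  "state_trajectory T f x u \<mu> y \<longleftrightarrow>
     (\<lambda>s. f (y s) (u s \<mu>) \<mu>) absolutely_integrable_on {0..T} \<and>
     (\<forall>t\<in>{0..T}. y t = x \<mu> + integral {0..t} (\<lambda>s. f (y s) (u s \<mu>) \<mu>))"

definition cost ::
    "real \<Rightarrow> (real^'d \<Rightarrow> real^'m \<Rightarrow> real) \<Rightarrow> (real \<Rightarrow> real^'p \<Rightarrow> real^'m) \<Rightarrow> real^'p \<Rightarrow>
     (real \<Rightarrow> real^'d) \<Rightarrow> real" where
  "cost T L u \<mu> y = integral {0..T} (\<lambda>t. L (y t) (u t \<mu>))"

text \<open>
  Uniqueness of the trajectory of a given control is not presupposed, so optimality is
  stated for control-trajectory pairs. Integrability of the running cost is required
  explicitly because \<^const>\<open>integral\<close> returns 0 for non-integrable functions.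
\<close>

definition feasible_pair ::
    "real \<Rightarrow> (real^'d \<Rightarrow> real^'m \<Rightarrow> real^'p \<Rightarrow> real^'d) \<Rightarrow> (real^'p \<Rightarrow> real^'d) \<Rightarrow>
     (real^'d \<Rightarrow> real^'m \<Rightarrow> real) \<Rightarrow> (real^'m) set \<Rightarrow> real^'p \<Rightarrow>
     (real \<Rightarrow> real^'p \<Rightarrow> real^'m) \<Rightarrow> (real \<Rightarrow> real^'d) \<Rightarrow> bool" where
  "feasible_pair T f x L Uad \<mu> u y \<longleftrightarrow>
     u \<in> admissible_controls T Uad \<and> state_trajectory T f x u \<mu> y \<and>
     (\<lambda>t. L (y t) (u t \<mu>)) absolutely_integrable_on {0..T}"

definition optimal_trajectory ::
    "real \<Rightarrow> (real^'d \<Rightarrow> real^'m \<Rightarrow> real^'p \<Rightarrow> real^'d) \<Rightarrow> (real^'p \<Rightarrow> real^'d) \<Rightarrow>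
     (real^'d \<Rightarrow> real^'m \<Rightarrow> real) \<Rightarrow> (real^'m) set \<Rightarrow> real^'p \<Rightarrow> (real \<Rightarrow> real^'d) \<Rightarrow> bool" where
  "optimal_trajectory T f x L Uad \<mu> y \<longleftrightarrow>
     (\<exists>u. feasible_pair T f x L Uad \<mu> u y \<and>
       (\<forall>v z. feasible_pair T f x L Uad \<mu> v z \<longrightarrow> cost T L u \<mu> y \<le> cost T L v \<mu> z))"

definition outer :: "real^'n \<Rightarrow> real^'n^'n" where
  "outer v = (\<chi> j k. v $ j * v $ k)"

definition charpoly :: "real^'n^'n \<Rightarrow> real poly" where
  "charpoly A = det (mat [:0, 1:] - map_matrix (\<lambda>a. [:a:]) A)"

text \<open>
  The \<open>j\<close>-th largest real eigenvalue, counted with multiplicity and with \<open>j\<close> starting at 1.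
  It is meaningful for all \<open>j \<in> {1..CARD('n)}\<close> when the characteristic polynomial splits over
  the reals, in particular when the matrix is symmetric.
\<close>

definition eigval_desc :: "real^'n^'n \<Rightarrow> nat \<Rightarrow> real" where
  "eigval_desc A j = rev (sorted_list_of_multiset (proots (charpoly A))) ! (j - 1)"

text \<open>
  The columns of \<open>U\<close> are orthonormal and are, in some order, eigenvectors for the \<open>CARD('l)\<close>
  largest eigenvalues.
\<close>

definition leading_eigenvectors :: "real^'n^'n \<Rightarrow> real^'l^'n \<Rightarrow> bool" where
  "leading_eigenvectors A U \<longleftrightarrow>
     transpose U ** U = mat 1 \<and>
     (\<exists>\<sigma>. bij_betw \<sigma> (UNIV :: 'l set) {1..CARD('l)} \<and>
          (\<forall>k. A *v column k U = eigval_desc A (\<sigma> k) *s column k U))"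

end

theory Submission
  imports Defs
begin

text \<open>
  Write \<open>P = U U\<^sup>T\<close> and let \<open>Q\<close> be the corresponding projection for \<open>G\<^sup>*\<close>. Since \<open>P\<close> depends only
  on the samples, the expected error is the expectation of the Frobenius inner product
  \<open>\<langle>I - P, G\<^sup>*\<rangle>\<close>. By Ky Fan's principle \<open>P\<close> maximizes \<open>\<langle>P, G\<rangle>\<close> among rank \<open>\<ell>\<close> projections, so
  \<open>\<langle>I - P, G\<^sup>*\<rangle> - \<langle>I - Q, G\<^sup>*\<rangle> \<le> \<langle>P - Q, G - G\<^sup>*\<rangle> \<le> 2 \<surd>\<ell> \<parallel>G - G\<^sup>*\<parallel>\<close>, and likewise
  \<open>\<Sum>\<^sub>j\<^sub>>\<^sub>\<ell> \<lambda>\<^sub>j\<^sup>* \<le> \<langle>I - P, G\<^sup>*\<rangle> \<le> \<Sum>\<^sub>j\<^sub>>\<^sub>\<ell> \<lambda>\<^sub>j + \<surd>(d - \<ell>) \<parallel>G - G\<^sup>*\<parallel>\<close>. The samples being independent,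
  the Frobenius norm satisfies \<open>E \<parallel>G - G\<^sup>*\<parallel> \<le> d C / \<surd>N\<close>.
\<close>

section \<open>Spectral theorem for symmetric real matrices\<close>

lemma inner_symmetric_matrix:
  fixes A :: "real^'n^'n"
  assumes "transpose A = A"
  shows "x \<bullet> (A *v y) = (A *v x) \<bullet> y"
  by (metis assms dot_lmul_matrix vector_transpose_matrix)

text \<open>Near \<open>s = 0\<close> the linear term dominates, so a nonzero \<open>b\<close> would
  produce a negative value at small \<open>s\<close> of opposite sign. This serves as the
  first-order optimality condition at a maximizer.\<close>

lemma quadratic_nonneg_imp_linear_coeff_zero:
  fixes b c :: real
  assumes "\<And>s. 0 \<le> s * b + s\<^sup>2 * c"
  shows "b = 0"
proof (rule ccontr)
  assume "b \<noteq> 0"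
  \<comment> \<open>Any positive \<open>k\<close> above \<open>c\<close> would do: at
    \<open>s = - b / k\<close> the expression equals
    \<open>(b\<^sup>2 / k) * (c / k - 1)\<close>.\<close>
  define k where "k = \<bar>c\<bar> + 1"
  have k: "k > 0" "c < k" by (auto simp: k_def)
  have "(- b / k) * b + (- b / k)\<^sup>2 * c = (b\<^sup>2 / k) * (c / k - 1)"
    using k by (simp add: field_simps power2_eq_square)
  also have "\<dots> < 0"
    using k \<open>b \<noteq> 0\<close> by (intro mult_pos_neg) (auto simp: field_simps)
  finally show False using assms[of "- b / k"] by linarith
qed

text \<open>The eigenvector is a maximizer of the Rayleigh quotient on \<open>S\<close>.\<close>

lemma symmetric_eigenvector_exists:
  fixes A :: "real^'n^'n"
  assumes A: "transpose A = A" and S: "subspace S" and inv: "\<And>x. x \<in> S \<Longrightarrow> A *v x \<in> S"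
    and "S \<noteq> {0}"
  obtains v e where "v \<in> S" "norm v = 1" "A *v v = e *\<^sub>R v"
proof -
  let ?K = "S \<inter> sphere 0 1"
  have "compact ?K" using closed_subspace[OF S] by (simp add: closed_Int_compact)
  moreover have "?K \<noteq> {}"
  proof -
    obtain w where "w \<in> S" "w \<noteq> 0" using S \<open>S \<noteq> {0}\<close> subspace_0 by blast
    then have "w /\<^sub>R norm w \<in> ?K" using S by (simp add: subspace_scale)
    then show ?thesis by blast
  qed
  moreover have "continuous_on ?K (\<lambda>x. x \<bullet> (A *v x))" by (intro continuous_intros)
  ultimately have "\<exists>v\<in>?K. \<forall>x\<in>?K. x \<bullet> (A *v x) \<le> v \<bullet> (A *v v)"
    by (rule continuous_attains_sup)
  then obtain v where v: "v \<in> ?K" and max: "\<And>x. x \<in> ?K \<Longrightarrow> x \<bullet> (A *v x) \<le> v \<bullet> (A *v v)"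
    by (elim bexE) metis
  define e where "e = v \<bullet> (A *v v)"
  have vv: "v \<bullet> v = 1" "v \<in> S" using v by (auto simp: norm_eq_1)
  \<comment> \<open>Homogeneity carries maximality from unit vectors over to all of
    \<open>S\<close>.\<close>
  have nonneg: "0 \<le> e * (x \<bullet> x) - x \<bullet> (A *v x)" if "x \<in> S" for x
  proof (cases "x = 0")
    case False
    have "x /\<^sub>R norm x \<in> ?K" using False that S by (simp add: subspace_scale)
    from max[OF this] have "(x \<bullet> (A *v x)) / (norm x)\<^sup>2 \<le> e"
      by (simp add: e_def matrix_vector_mult_scaleR divide_inverse power2_eq_square mult_ac)
    then show ?thesis using False by (simp add: field_simps power2_norm_eq_inner)
  qed simp
  define r where "r = e *\<^sub>R v - A *v v"
  have "r \<in> S" using S vv inv by (simp add: r_def subspace_diff subspace_scale)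
  \<comment> \<open>The maximizer is perturbed in the direction of the residual \<open>r\<close>
    itself, so the linear coefficient is \<open>2 * (r \<bullet> r)\<close>; its vanishing makes
    \<open>v\<close> an eigenvector.\<close>
  have "0 \<le> s * (2 * (r \<bullet> r)) + s\<^sup>2 * (e * (r \<bullet> r) - r \<bullet> (A *v r))" for s
  proof -
    have "v + s *\<^sub>R r \<in> S" using S vv \<open>r \<in> S\<close> by (simp add: subspace_add subspace_scale)
    from nonneg[OF this]
    have "0 \<le> e * ((v + s *\<^sub>R r) \<bullet> (v + s *\<^sub>R r)) - (v + s *\<^sub>R r) \<bullet> (A *v (v + s *\<^sub>R r))" .
    also have "\<dots> = s * (2 * (r \<bullet> (e *\<^sub>R v - A *v v))) + s\<^sup>2 * (e * (r \<bullet> r) - r \<bullet> (A *v r))"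
      using inner_symmetric_matrix[OF A, of v r] vv
      by (simp add: inner_simps matrix_vector_right_distrib matrix_vector_mult_scaleR
          e_def[symmetric] power2_eq_square inner_commute algebra_simps)
    finally show ?thesis by (simp add: r_def)
  qed
  from quadratic_nonneg_imp_linear_coeff_zero[OF this] have "A *v v = e *\<^sub>R v"
    by (simp add: r_def)
  then show ?thesis using that vv by (auto simp: norm_eq_1)
qed

text \<open>Induction on the dimension: once a unit eigenvector \<open>v\<close> is split off, its
  orthogonal complement inside \<open>S\<close> has smaller dimension and is again invariant because
  \<open>A\<close> is symmetric.\<close>

lemma symmetric_invariant_subspace_eigenbasis:
  fixes A :: "real^'n^'n"
  assumes A: "transpose A = A" and "subspace S" and "\<And>x. x \<in> S \<Longrightarrow> A *v x \<in> S"
  shows "\<exists>B. pairwise orthogonal B \<and> span B = S \<and> (\<forall>b\<in>B. norm b = 1 \<and> (\<exists>e. A *v b = e *\<^sub>R b))"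
  using assms(2,3)
proof (induction "dim S" arbitrary: S rule: less_induct)
  case less
  show ?case
  proof (cases "S = {0}")
    case True
    then show ?thesis by (intro exI[of _ "{}"]) auto
  next
    case False
    from symmetric_eigenvector_exists[OF A less.prems False]
    obtain v e where v: "v \<in> S" "norm v = 1" "A *v v = e *\<^sub>R v" .
    define S' where "S' = {x \<in> S. x \<bullet> v = 0}"
    have sub: "subspace S'"
      using less.prems(1) by (auto simp: S'_def subspace_def inner_simps)
    have "v \<notin> S'" using v by (simp add: S'_def norm_eq_1)
    then have "dim S' < dim S"
      using sub less.prems v
      by (intro dim_psubset) (metis (no_types, lifting) S'_def mem_Collect_eq psubsetI span_eq_iff subsetI)
    moreover have "A *v x \<in> S'" if "x \<in> S'" for x
      using that less.prems v inner_symmetric_matrix[OF A, of x v] by (simp add: S'_def)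
    ultimately obtain B where B: "pairwise orthogonal B" "span B = S'"
        "\<And>b. b \<in> B \<Longrightarrow> norm b = 1 \<and> (\<exists>e. A *v b = e *\<^sub>R b)"
      using less.hyps[OF _ sub] by blast
    have orth: "b \<bullet> v = 0" if "b \<in> B" for b
      using that B(2) span_base[of b B] by (auto simp: S'_def)
    have "S \<subseteq> span (insert v B)"
    proof
      fix x assume "x \<in> S"
      then have "x - (x \<bullet> v) *\<^sub>R v \<in> span B"
        using less.prems v by (simp add: B S'_def subspace_diff subspace_scale inner_simps norm_eq_1)
      then show "x \<in> span (insert v B)" by (auto simp: span_insert)
    qed
    moreover have "span (insert v B) \<subseteq> S"
      using v B(2) span_superset[of B] less.prems(1)
      by (intro span_minimal) (auto simp: S'_def)
    ultimately show ?thesis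
      using B v orth
      by (intro exI[of _ "insert v B"]) (auto simp: pairwise_insert orthogonal_def inner_commute)
  qed
qed

text \<open>With the eigenvectors as columns of \<open>Q\<close>, diagonalization lifts to
  \<open>(X I - A) Q = Q D\<close> over the polynomial ring, where \<open>D\<close> is diagonal with
  entries \<open>X - e k\<close>. Taking determinants and cancelling that of \<open>Q\<close> gives
  the product.\<close>

lemma charpoly_eigenbasis:
  fixes A :: "real^'n^'n" and q :: "'n \<Rightarrow> real^'n"
  assumes orth: "\<And>i k. q i \<bullet> q k = (if i = k then 1 else 0)"
    and eig: "\<And>k. A *v q k = e k *\<^sub>R q k"
  shows "charpoly A = (\<Prod>k\<in>UNIV. [:- e k, 1:])"
proof -
  let ?p = "map_matrix (\<lambda>a::real. [:a:])"
  define Q :: "real^'n^'n" where "Q = (\<chi> i k. q k $ i)"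
  define D :: "real poly^'n^'n" where "D = (\<chi> i k. if i = k then [:- e k, 1:] else 0)"
  have const_sum: "[:sum f S:] = (\<Sum>i\<in>S. [:f i:])" for f :: "'n \<Rightarrow> real" and S
    by (induction S rule: infinite_finite_induct) (auto, metis add_pCons add_0)
  have const_mult: "?p X ** ?p Y = ?p (X ** Y)" for X Y :: "real^'n^'n"
    by (simp add: vec_eq_iff matrix_matrix_mult_def const_sum mult.commute)
  have "transpose Q ** Q = mat 1"
    using orth by (simp add: vec_eq_iff Q_def matrix_matrix_mult_def transpose_def inner_vec_def mat_def)
  then have "?p (transpose Q) ** ?p Q = mat 1"
    by (simp add: const_mult) (simp add: vec_eq_iff mat_def)
  \<comment> \<open>Orthonormality makes the determinant of \<open>Q\<close> a unit, so it can be
    cancelled at the end.\<close>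
  then have "det (?p (transpose Q)) * det (?p Q) = 1"
    by (metis det_I det_mul)
  then have nz: "det (?p Q) \<noteq> 0" by auto
  have AQ: "(\<Sum>j\<in>UNIV. A $ i $ j * Q $ j $ k) = e k * Q $ i $ k" for i k
    using eig[of k] by (simp add: vec_eq_iff matrix_vector_mult_def Q_def)
  have "(mat [:0, 1:] - ?p A) ** ?p Q = ?p Q ** D"
  proof -
    have "((mat [:0, 1:] - ?p A) ** ?p Q) $ i $ k = (?p Q ** D) $ i $ k" for i k
    proof -
      have "((mat [:0, 1:] - ?p A) ** ?p Q) $ i $ k
          = (\<Sum>j\<in>UNIV. (if j = i then [:0, 1:] * [:Q $ j $ k:] else 0) - [:A $ i $ j * Q $ j $ k:])"
        by (auto simp: matrix_matrix_mult_def mat_def algebra_simps intro!: sum.cong)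
      also have "\<dots> = [:0, 1:] * [:Q $ i $ k:] - [:\<Sum>j\<in>UNIV. A $ i $ j * Q $ j $ k:]"
        by (simp only: sum_subtractf const_sum sum.delta finite UNIV_I if_True)
      also have "\<dots> = [:Q $ i $ k:] * [:- e k, 1:]"
        by (simp add: AQ)
      also have "\<dots> = (?p Q ** D) $ i $ k"
        by (simp add: matrix_matrix_mult_def D_def if_distrib cong: if_cong)
      finally show ?thesis .
    qed
    then show ?thesis by (simp add: vec_eq_iff)
  qed
  then have "charpoly A * det (?p Q) = det (?p Q) * det D"
    by (metis charpoly_def det_mul)
  then have "charpoly A = det D" using nz by (simp add: mult.commute)
  also have "\<dots> = (\<Prod>k\<in>UNIV. D $ k $ k)"
    by (rule det_diagonal) (simp add: D_def)
  finally show ?thesis by (simp add: D_def)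
qed

text \<open>This links \<open>eigval_desc\<close>, which is read off the sorted roots of the
  characteristic polynomial, to actual eigenvectors: sorting an orthonormal eigenbasis by eigenvalue
  puts a vector for the \<open>j\<close>-th root at position \<open>j\<close>.\<close>

lemma symmetric_eigen_desc:
  fixes A :: "real^'n^'n"
  assumes A: "transpose A = A"
  obtains v :: "nat \<Rightarrow> real^'n" where
    "\<And>i j. i \<in> {1..CARD('n)} \<Longrightarrow> j \<in> {1..CARD('n)} \<Longrightarrow> v i \<bullet> v j = (if i = j then 1 else 0)"
    "\<And>j. j \<in> {1..CARD('n)} \<Longrightarrow> A *v v j = eigval_desc A j *\<^sub>R v j"
    "\<And>i j. 1 \<le> i \<Longrightarrow> i \<le> j \<Longrightarrow> j \<le> CARD('n) \<Longrightarrow> eigval_desc A j \<le> eigval_desc A i"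
proof -
  obtain B where B: "pairwise orthogonal B" "span B = UNIV"
      "\<And>b. b \<in> B \<Longrightarrow> norm b = 1 \<and> (\<exists>e. A *v b = e *\<^sub>R b)"
    using symmetric_invariant_subspace_eigenbasis[OF A, of UNIV] by auto
  have "0 \<notin> B" using B(3) by fastforce
  then have ind: "independent B" using B(1) by (rule pairwise_orthogonal_independent[rotated])
  have fin: "finite B" using ind by (rule independent_imp_finite)
  have card: "card B = CARD('n)"
    using dim_eq_card[OF _ ind, of UNIV] B(2) by simp
  \<comment> \<open>On a unit eigenvector the quadratic form returns the eigenvalue, which gives
    \<open>e\<close> in closed form.\<close>
  define e where "e b = b \<bullet> (A *v b)" for b :: "real^'n"
  have eig: "A *v b = e b *\<^sub>R b" if "b \<in> B" for b
    using B(3)[OF that] by (auto simp: e_def norm_eq_1)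
  have orth: "b \<bullet> c = (if b = c then 1 else 0)" if "b \<in> B" "c \<in> B" for b c
    using that B(1) B(3)[OF that(1)] by (auto simp: pairwise_def orthogonal_def norm_eq_1)
  obtain bs where bs: "set bs = B" "distinct bs" using fin finite_distinct_list by blast
  \<comment> \<open>\<open>sort_key\<close> sorts upwards, hence the reversal. Eigenvalues are
    counted from 1 and list entries from 0, hence the index \<open>j - 1\<close> below.\<close>
  define ss where "ss = rev (sort_key e bs)"
  have ss: "set ss = B" "distinct ss" "length ss = CARD('n)"
    using bs distinct_card[of bs] card by (simp_all add: ss_def)
  obtain q where q: "bij_betw q (UNIV :: 'n set) B"
    using fin card by (metis finite finite_same_card_bij)
  have "charpoly A = (\<Prod>k\<in>UNIV. [:- e (q k), 1:])"
    using q orth eig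
    by (intro charpoly_eigenbasis[of q]) (auto simp: bij_betw_def inj_on_def)
  also have "\<dots> = (\<Prod>b\<in>B. [:- e b, 1:])"
    by (rule prod.reindex_bij_betw[OF q])
  finally have "proots (charpoly A) = (\<Sum>b\<in>set bs. {#e b#})"
    using bs by (simp add: proots_prod)
  also have "\<dots> = mset (map e bs)"
    using bs(2) by (induction bs) auto
  finally have "eigval_desc A j = rev (sort (map e bs)) ! (j - 1)" for j
    by (simp add: eigval_desc_def flip: mset_map)
  moreover have "sort (map e bs) = map e (sort_key e bs)"
    by (rule properties_for_sort) auto
  ultimately have ev: "eigval_desc A j = map e ss ! (j - 1)" for j
    by (simp add: ss_def rev_map)
  have ev': "eigval_desc A j = e (ss ! (j - 1))" if "j \<in> {1..CARD('n)}" for j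
    using that ss by (subst ev) (auto intro!: nth_map)
  have desc: "sorted_wrt (\<ge>) (map e ss)"
    by (simp add: ss_def rev_map[symmetric] sorted_wrt_rev)
  show ?thesis
  proof (rule that[of "\<lambda>j. ss ! (j - 1)"])
    fix j assume j: "j \<in> {1..CARD('n)}"
    then have "ss ! (j - 1) \<in> B" using ss(1,3) nth_mem[of "j - 1" ss] by auto
    then show "A *v (ss ! (j - 1)) = eigval_desc A j *\<^sub>R (ss ! (j - 1))"
      using eig ev'[OF j] by simp
    fix i assume i: "i \<in> {1..CARD('n)}"
    then have "ss ! (i - 1) \<in> B" using ss(1,3) nth_mem[of "i - 1" ss] by auto
    moreover have "ss ! (i - 1) = ss ! (j - 1) \<longleftrightarrow> i = j"
      using i j nth_eq_iff_index_eq[OF ss(2)] unfolding ss(3) by (cases i; cases j) auto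
    ultimately show "ss ! (i - 1) \<bullet> ss ! (j - 1) = (if i = j then 1 else 0)"
      using orth \<open>ss ! (j - 1) \<in> B\<close> by simp
  next
    fix i j :: nat assume ij: "1 \<le> i" "i \<le> j" "j \<le> CARD('n)"
    show "eigval_desc A j \<le> eigval_desc A i"
      using ij sorted_wrt_nth_less[OF desc, of "i - 1" "j - 1"] ss
      by (cases "i = j") (auto simp: ev)
  qed
qed

section \<open>Ky Fan's principle and perturbation of leading eigenspaces\<close>

lemma inner_outer:
  fixes P :: "real^'n^'n"
  shows "P \<bullet> outer v = v \<bullet> (P *v v)"
  by (simp add: inner_vec_def outer_def matrix_vector_mult_def sum_distrib_left mult_ac)

lemma outer_mult_vector: "outer u *v v = (u \<bullet> v) *\<^sub>R u" for u v :: "real^'n"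
  by (simp add: vec_eq_iff outer_def matrix_vector_mult_def inner_vec_def sum_distrib_left mult_ac)

lemma matrix_mult_outer:
  fixes A :: "real^'n^'n"
  assumes "A *v v = e *\<^sub>R v"
  shows "A ** outer v = e *\<^sub>R outer v"
proof -
  have "(\<Sum>k\<in>UNIV. A $ i $ k * v $ k) = e * v $ i" for i
    using assms by (simp add: vec_eq_iff matrix_vector_mult_def)
  then show ?thesis
    by (simp add: vec_eq_iff matrix_matrix_mult_def outer_def mult.assoc[symmetric]
        flip: sum_distrib_right)
qed

lemma matrix_mult_sum_right:
  fixes A :: "real^'n^'m" and B :: "'k \<Rightarrow> real^'p^'n"
  shows "A ** (\<Sum>k\<in>K. B k) = (\<Sum>k\<in>K. A ** B k)"
  by (induction K rule: infinite_finite_induct) (simp_all add: matrix_add_ldistrib)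

lemma matrix_mult_transpose_columns:
  fixes U :: "real^'l^'n"
  shows "U ** transpose U = (\<Sum>k\<in>UNIV. outer (column k U))"
  by (simp add: vec_eq_iff matrix_matrix_mult_def transpose_def outer_def column_def)

lemma transpose_mult_transpose:
  fixes U :: "real^'l^'n"
  shows "transpose (U ** transpose U) = U ** transpose U"
  by (simp add: matrix_transpose_mul)

lemma orthonormal_columns_projection:
  fixes U :: "real^'l^'n"
  assumes U: "transpose U ** U = mat 1"
  shows "(U ** transpose U) ** (U ** transpose U) = U ** transpose U"
  by (metis U matrix_mul_assoc matrix_mul_rid)

lemma column_inner_column:
  fixes U :: "real^'l^'n"
  assumes "transpose U ** U = mat 1"
  shows "column i U \<bullet> column k U = (if i = k then 1 else 0)"
proof -
  have "column i U \<bullet> column k U = (transpose U ** U) $ i $ k"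
    by (simp add: matrix_mult_transpose_dot_column)
  then show ?thesis by (simp add: assms mat_def)
qed

lemma inner_mat_1_outer: "mat 1 \<bullet> outer v = v \<bullet> (v :: real^'n)"
  by (simp add: inner_outer)

text \<open>Pairing with \<open>mat 1\<close> is the trace, to which each orthonormal column
  contributes 1.\<close>

lemma inner_mat_1_projection:
  fixes U :: "real^'l^'n"
  assumes "transpose U ** U = mat 1"
  shows "mat 1 \<bullet> (U ** transpose U) = real CARD('l)"
  by (simp add: matrix_mult_transpose_columns inner_sum_right inner_mat_1_outer
      column_inner_column[OF assms])

lemma inner_symmetric_eq_inner_mat_1:
  fixes P :: "real^'n^'n"
  assumes "transpose P = P"
  shows "P \<bullet> A = mat 1 \<bullet> (P ** A)"
proof -
  have "P $ i $ j = P $ j $ i" for i j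
    by (metis assms transpose_def vec_lambda_beta)
  then have "mat 1 \<bullet> (P ** A) = (\<Sum>i\<in>UNIV. \<Sum>j\<in>UNIV. P $ j $ i * A $ j $ i)"
    by (simp add: inner_vec_def mat_def matrix_matrix_mult_def mult_delta_left)
  also have "\<dots> = P \<bullet> A"
    by (subst sum.swap) (simp add: inner_vec_def)
  finally show ?thesis by simp
qed

lemma inner_projection_self:
  fixes U :: "real^'l^'n"
  assumes "transpose U ** U = mat 1"
  shows "(U ** transpose U) \<bullet> (U ** transpose U) = real CARD('l)"
  using assms
  by (simp add: inner_symmetric_eq_inner_mat_1[OF transpose_mult_transpose]
      orthonormal_columns_projection inner_mat_1_projection)

lemma norm_projection:
  fixes U :: "real^'l^'n"
  assumes "transpose U ** U = mat 1"
  shows "norm (U ** transpose U) = sqrt (real CARD('l))"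
  by (simp add: norm_eq_sqrt_inner inner_projection_self[OF assms])

lemma norm_complement_projection:
  fixes U :: "real^'l^'n"
  assumes "transpose U ** U = mat 1"
  shows "norm (mat 1 - U ** transpose U) = sqrt (real CARD('n) - real CARD('l))"
proof -
  have "mat 1 \<bullet> (mat 1 :: real^'n^'n) = real CARD('n)"
    by (simp add: inner_vec_def mat_def if_distrib cong: if_cong)
  then show ?thesis
    using inner_projection_self[OF assms] inner_mat_1_projection[OF assms]
    by (simp add: norm_eq_sqrt_inner inner_diff_left inner_diff_right inner_commute)
qed

text \<open>The squared Frobenius norm of the complementary projection is the difference of the two
  dimensions. Since \<open>sqrt\<close> of a negative real is negative, a nonnegative norm forces
  this difference to be nonnegative.\<close>

lemma card_le_of_orthonormal_columns:
  fixes U :: "real^'l^'n"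
  assumes "transpose U ** U = mat 1"
  shows "CARD('l) \<le> CARD('n)"
proof -
  have "0 \<le> sqrt (real CARD('n) - real CARD('l))"
    using norm_complement_projection[OF assms] by (metis norm_ge_zero)
  then show ?thesis by simp
qed

text \<open>Symmetry and idempotence of the projection reduce the squared residual to a quadratic
  form in \<open>z\<close>. Written as a pairing, it is linear in \<open>outer z\<close>, so
  projection and data can later be averaged separately.\<close>

lemma norm_diff_projection:
  fixes U :: "real^'l^'n"
  assumes "transpose U ** U = mat 1"
  shows "(norm (z - (U ** transpose U) *v z))\<^sup>2 = (mat 1 - U ** transpose U) \<bullet> outer z"
proof -
  let ?P = "U ** transpose U"
  have "(?P *v z) \<bullet> (?P *v z) = z \<bullet> (?P *v z)"
    using inner_symmetric_matrix[OF transpose_mult_transpose, of z U "?P *v z"]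
      orthonormal_columns_projection[OF assms] by (simp add: matrix_vector_mul_assoc)
  then show ?thesis
    using inner_commute[of "?P *v z" z]
    by (simp add: power2_norm_eq_inner inner_outer matrix_vector_mult_diff_rdistrib
        inner_diff_left inner_diff_right)
qed

text \<open>These numbers are the weights in Ky Fan's principle. Each is a sum of squared
  coordinates along the columns, and its difference to 1 is a squared residual.\<close>

lemma inner_projection_bounds:
  fixes U :: "real^'l^'n"
  assumes "transpose U ** U = mat 1" and "v \<bullet> v = 1"
  shows "0 \<le> v \<bullet> ((U ** transpose U) *v v)" "v \<bullet> ((U ** transpose U) *v v) \<le> 1"
proof -
  let ?P = "U ** transpose U"
  have "v \<bullet> (?P *v v) = (\<Sum>k\<in>UNIV. (column k U \<bullet> v)\<^sup>2)"
    unfolding inner_outer[symmetric] matrix_mult_transpose_columns inner_sum_left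
    by (simp add: inner_outer outer_mult_vector inner_commute power2_eq_square)
  then show "0 \<le> v \<bullet> (?P *v v)" by (simp add: sum_nonneg)
  have "0 \<le> (mat 1 - ?P) \<bullet> outer v"
    by (metis norm_diff_projection[OF assms(1)] zero_le_power2)
  then show "v \<bullet> (?P *v v) \<le> 1"
    using assms(2) unfolding inner_diff_left by (simp add: inner_outer)
qed

text \<open>The eigenvectors form a square matrix \<open>V\<close> with
  \<open>transpose V ** V = mat 1\<close>. A left inverse of a square matrix is also a right
  inverse, which resolves the identity into rank-one terms; multiplying by \<open>A\<close> then
  expands \<open>A\<close>.\<close>

lemma spectral_decomposition:
  fixes A :: "real^'n^'n"
  assumes A: "transpose A = A"
  obtains v :: "nat \<Rightarrow> real^'n" where
    "\<And>i j. i \<in> {1..CARD('n)} \<Longrightarrow> j \<in> {1..CARD('n)} \<Longrightarrow> v i \<bullet> v j = (if i = j then 1 else 0)"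
    "\<And>j. j \<in> {1..CARD('n)} \<Longrightarrow> A *v v j = eigval_desc A j *\<^sub>R v j"
    "\<And>i j. 1 \<le> i \<Longrightarrow> i \<le> j \<Longrightarrow> j \<le> CARD('n) \<Longrightarrow> eigval_desc A j \<le> eigval_desc A i"
    "mat 1 = (\<Sum>j=1..CARD('n). outer (v j))"
    "A = (\<Sum>j=1..CARD('n). eigval_desc A j *\<^sub>R outer (v j))"
proof -
  obtain v :: "nat \<Rightarrow> real^'n" where v:
    "\<And>i j. i \<in> {1..CARD('n)} \<Longrightarrow> j \<in> {1..CARD('n)} \<Longrightarrow> v i \<bullet> v j = (if i = j then 1 else 0)"
    "\<And>j. j \<in> {1..CARD('n)} \<Longrightarrow> A *v v j = eigval_desc A j *\<^sub>R v j"
    "\<And>i j. 1 \<le> i \<Longrightarrow> i \<le> j \<Longrightarrow> j \<le> CARD('n) \<Longrightarrow> eigval_desc A j \<le> eigval_desc A i"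
    using symmetric_eigen_desc[OF A] by blast
  obtain h where h: "bij_betw h (UNIV :: 'n set) {1..CARD('n)}"
    by (metis card_atLeastAtMost diff_Suc_1 finite finite_atLeastAtMost finite_same_card_bij)
  define V :: "real^'n^'n" where "V = (\<chi> i k. v (h k) $ i)"
  have col: "column k V = v (h k)" for k
    by (simp add: V_def column_def vec_eq_iff)
  have hin: "h k \<in> {1..CARD('n)}" for k using h by (auto simp: bij_betw_def)
  have hinj: "h i = h k \<longleftrightarrow> i = k" for i k using h by (auto simp: bij_betw_def inj_on_def)
  have "transpose V ** V = mat 1"
    using v(1)[OF hin hin] by (simp add: matrix_mult_transpose_dot_column col vec_eq_iff mat_def hinj)
  then have "mat 1 = V ** transpose V"
    by (simp add: matrix_left_right_inverse)
  also have "\<dots> = (\<Sum>k\<in>UNIV. outer (v (h k)))"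
    by (simp add: matrix_mult_transpose_columns col)
  also have "\<dots> = (\<Sum>j=1..CARD('n). outer (v j))"
    by (rule sum.reindex_bij_betw[OF h])
  finally have one: "mat 1 = (\<Sum>j=1..CARD('n). outer (v j))" .
  have "A = A ** mat 1" by simp
  also have "\<dots> = (\<Sum>j=1..CARD('n). eigval_desc A j *\<^sub>R outer (v j))"
    unfolding one matrix_mult_sum_right by (intro sum.cong refl matrix_mult_outer v(2))
  finally show ?thesis using that v one by blast
qed

section \<open>Eigenvalue sums and Ky Fan's principle\<close>

lemma sum_eigval_desc:
  fixes A :: "real^'n^'n"
  assumes A: "transpose A = A"
  shows "(\<Sum>j=1..CARD('n). eigval_desc A j) = mat 1 \<bullet> A"
proof -
  obtain v :: "nat \<Rightarrow> real^'n" where v: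
    "\<And>i j. i \<in> {1..CARD('n)} \<Longrightarrow> j \<in> {1..CARD('n)} \<Longrightarrow> v i \<bullet> v j = (if i = j then 1 else 0)"
    "A = (\<Sum>j=1..CARD('n). eigval_desc A j *\<^sub>R outer (v j))"
    using spectral_decomposition[OF A] by metis
  have "mat 1 \<bullet> A = (\<Sum>j=1..CARD('n). eigval_desc A j * (v j \<bullet> v j))"
    by (subst v(2)) (simp add: inner_sum_right inner_mat_1_outer)
  also have "\<dots> = (\<Sum>j=1..CARD('n). eigval_desc A j)"
    using v(1) by (intro sum.cong) auto
  finally show ?thesis by simp
qed

text \<open>After \<open>a l\<close> is subtracted from every value, those up to \<open>l\<close>
  are nonnegative and the later ones nonpositive, so weight 1 on the former and 0 on the latter is
  best. As the weights add up to \<open>l\<close>, the shift changes both sides equally.\<close>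

lemma weighted_sum_le_sum_largest:
  fixes a w :: "nat \<Rightarrow> real"
  assumes desc: "\<And>i j. 1 \<le> i \<Longrightarrow> i \<le> j \<Longrightarrow> j \<le> n \<Longrightarrow> a j \<le> a i"
    and w: "\<And>j. j \<in> {1..n} \<Longrightarrow> 0 \<le> w j" "\<And>j. j \<in> {1..n} \<Longrightarrow> w j \<le> 1"
    and sum_w: "(\<Sum>j=1..n. w j) = real l" and l: "1 \<le> l" "l \<le> n"
  shows "(\<Sum>j=1..n. a j * w j) \<le> (\<Sum>j=1..l. a j)"
proof -
  have sub: "(\<Sum>j=1..n. if j \<le> l then g j else 0) = (\<Sum>j=1..l. g j)" for g :: "nat \<Rightarrow> real"
    using l by (intro sum.mono_neutral_cong_right) auto
  have "(\<Sum>j=1..n. a j * w j) - a l * real l = (\<Sum>j=1..n. (a j - a l) * w j)"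
    by (simp add: sum_w[symmetric] sum_distrib_left algebra_simps sum_subtractf)
  also have "\<dots> \<le> (\<Sum>j=1..n. if j \<le> l then a j - a l else 0)"
  proof (intro sum_mono)
    fix j assume j: "j \<in> {1..n}"
    show "(a j - a l) * w j \<le> (if j \<le> l then a j - a l else 0)"
    proof (cases "j \<le> l")
      case True
      then show ?thesis using desc[of j l] j w l by (simp add: mult_left_le)
    next
      case False
      then show ?thesis using desc[of l j] j w l by (simp add: mult_nonpos_nonneg)
    qed
  qed
  also have "\<dots> = (\<Sum>j=1..l. a j) - a l * real l"
    by (subst sub) (simp add: sum_subtractf mult.commute)
  finally show ?thesis by simp
qed

text \<open>Upper bound in Ky Fan's principle: expanding \<open>A\<close> in its eigenbasis gives a
  weighted sum of eigenvalues, with weights in [0,1] whose total is the trace of the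
  projection.\<close>

lemma inner_projection_le_sum_eigval_desc:
  fixes A :: "real^'n^'n" and U :: "real^'l^'n"
  assumes A: "transpose A = A" and U: "transpose U ** U = mat 1"
  shows "(U ** transpose U) \<bullet> A \<le> (\<Sum>j=1..CARD('l). eigval_desc A j)"
proof -
  let ?P = "U ** transpose U"
  obtain v :: "nat \<Rightarrow> real^'n" where v:
    "\<And>i j. i \<in> {1..CARD('n)} \<Longrightarrow> j \<in> {1..CARD('n)} \<Longrightarrow> v i \<bullet> v j = (if i = j then 1 else 0)"
    "\<And>j. j \<in> {1..CARD('n)} \<Longrightarrow> A *v v j = eigval_desc A j *\<^sub>R v j"
    "\<And>i j. 1 \<le> i \<Longrightarrow> i \<le> j \<Longrightarrow> j \<le> CARD('n) \<Longrightarrow> eigval_desc A j \<le> eigval_desc A i"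
    "mat 1 = (\<Sum>j=1..CARD('n). outer (v j))"
    "A = (\<Sum>j=1..CARD('n). eigval_desc A j *\<^sub>R outer (v j))"
    using spectral_decomposition[OF A] by blast
  have "?P \<bullet> A = (\<Sum>j=1..CARD('n). eigval_desc A j * (v j \<bullet> (?P *v v j)))"
    by (subst v(5)) (simp add: inner_sum_right inner_outer)
  also have "\<dots> \<le> (\<Sum>j=1..CARD('l). eigval_desc A j)"
  proof (rule weighted_sum_le_sum_largest)
    have "?P \<bullet> mat 1 = real CARD('l)"
      using inner_mat_1_projection[OF U] by (simp add: inner_commute)
    then show "(\<Sum>j=1..CARD('n). v j \<bullet> (?P *v v j)) = real CARD('l)"
      unfolding v(4) by (simp add: inner_sum_right inner_outer)
  qed (use v inner_projection_bounds[OF U] card_le_of_orthonormal_columns[OF U] in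
      \<open>auto simp: Suc_le_eq\<close>)
  finally show ?thesis .
qed

text \<open>Equality case of Ky Fan's principle. The order \<open>\<sigma>\<close> in which the
  columns realize the leading eigenvalues does not affect the sum.\<close>

lemma inner_leading_projection:
  fixes A :: "real^'n^'n" and U :: "real^'l^'n"
  assumes "leading_eigenvectors A U"
  shows "(U ** transpose U) \<bullet> A = (\<Sum>j=1..CARD('l). eigval_desc A j)"
proof -
  obtain \<sigma> where \<sigma>: "bij_betw \<sigma> (UNIV :: 'l set) {1..CARD('l)}"
      "\<And>k. A *v column k U = eigval_desc A (\<sigma> k) *s column k U"
    and U: "transpose U ** U = mat 1"
    using assms unfolding leading_eigenvectors_def by blast
  have "(U ** transpose U) \<bullet> A = (\<Sum>k\<in>UNIV. column k U \<bullet> (A *v column k U))"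
    by (simp add: matrix_mult_transpose_columns inner_sum_left)
      (simp add: inner_commute[of "outer _"] inner_outer)
  also have "\<dots> = (\<Sum>k\<in>UNIV. eigval_desc A (\<sigma> k))"
    by (simp add: \<sigma> column_inner_column[OF U] scalar_mult_eq_scaleR)
  also have "\<dots> = (\<Sum>j=1..CARD('l). eigval_desc A j)"
    by (rule sum.reindex_bij_betw[OF \<sigma>(1)])
  finally show ?thesis .
qed

text \<open>Supplies the comparison projection for a matrix that comes without chosen eigenvectors;
  in the application this is the true second moment matrix.\<close>

lemma leading_eigenvectors_exist:
  fixes A :: "real^'n^'n"
  assumes A: "transpose A = A" and l: "CARD('l) \<le> CARD('n)"
  obtains U :: "real^'l^'n" where "leading_eigenvectors A U"
proof -
  obtain v :: "nat \<Rightarrow> real^'n" where v: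
    "\<And>i j. i \<in> {1..CARD('n)} \<Longrightarrow> j \<in> {1..CARD('n)} \<Longrightarrow> v i \<bullet> v j = (if i = j then 1 else 0)"
    "\<And>j. j \<in> {1..CARD('n)} \<Longrightarrow> A *v v j = eigval_desc A j *\<^sub>R v j"
    using spectral_decomposition[OF A] by metis
  obtain h where h: "bij_betw h (UNIV :: 'l set) {1..CARD('l)}"
    by (metis card_atLeastAtMost diff_Suc_1 finite finite_atLeastAtMost finite_same_card_bij)
  define U :: "real^'l^'n" where "U = (\<chi> i k. v (h k) $ i)"
  have col: "column k U = v (h k)" for k
    by (simp add: U_def column_def vec_eq_iff)
  have "h k \<in> {1..CARD('l)}" for k using h by (auto simp: bij_betw_def)
  then have hin: "h k \<in> {1..CARD('n)}" for k using l by (meson atLeastAtMost_iff le_trans)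
  have hinj: "h i = h k \<longleftrightarrow> i = k" for i k using h by (auto simp: bij_betw_def inj_on_def)
  have "transpose U ** U = mat 1"
    using v(1)[OF hin hin] by (simp add: matrix_mult_transpose_dot_column col vec_eq_iff mat_def hinj)
  then have "leading_eigenvectors A U"
    unfolding leading_eigenvectors_def using h v(2)[OF hin]
    by (auto simp: col scalar_mult_eq_scaleR)
  then show ?thesis by (rule that)
qed

lemma sum_trailing_eigval_desc:
  fixes A :: "real^'n^'n"
  assumes "transpose A = A" and "l \<le> CARD('n)"
  shows "(\<Sum>j=l+1..CARD('n). eigval_desc A j) = mat 1 \<bullet> A - (\<Sum>j=1..l. eigval_desc A j)"
proof -
  have "{1..CARD('n)} = {1..l} \<union> {l+1..CARD('n)}" using assms(2) by auto
  then have "(\<Sum>j=1..CARD('n). eigval_desc A j)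
      = (\<Sum>j=1..l. eigval_desc A j) + (\<Sum>j=l+1..CARD('n). eigval_desc A j)"
    by (simp add: sum.union_disjoint)
  then show ?thesis using sum_eigval_desc[OF assms(1)] by simp
qed

lemma inner_complement_leading_projection:
  fixes A :: "real^'n^'n" and U :: "real^'l^'n"
  assumes A: "transpose A = A" and U: "leading_eigenvectors A U"
  shows "(mat 1 - U ** transpose U) \<bullet> A = (\<Sum>j=CARD('l)+1..CARD('n). eigval_desc A j)"
  using sum_trailing_eigval_desc[OF A card_le_of_orthonormal_columns[of U]] U
    inner_leading_projection[OF U]
  by (simp add: leading_eigenvectors_def inner_diff_left)

lemma sum_trailing_eigval_desc_le:
  fixes A :: "real^'n^'n" and U :: "real^'l^'n"
  assumes A: "transpose A = A" and U: "transpose U ** U = mat 1"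
  shows "(\<Sum>j=CARD('l)+1..CARD('n). eigval_desc A j) \<le> (mat 1 - U ** transpose U) \<bullet> A"
  using sum_trailing_eigval_desc[OF A card_le_of_orthonormal_columns[OF U]]
    inner_projection_le_sum_eigval_desc[OF A U]
  by (simp add: inner_diff_left)

text \<open>The leading projection of \<open>B\<close> beats that of \<open>A\<close> when paired
  with \<open>B\<close>, so what it loses on \<open>A\<close> is controlled by \<open>B - A\<close>.
  Cauchy-Schwarz finishes, each projection having norm \<open>sqrt (real CARD('l))\<close>.\<close>

lemma leading_projection_perturbation:
  fixes A B :: "real^'n^'n" and U :: "real^'l^'n"
  assumes A: "transpose A = A" and B: "transpose B = B" and U: "leading_eigenvectors B U"
  shows "(mat 1 - U ** transpose U) \<bullet> A
    \<le> (\<Sum>j=CARD('l)+1..CARD('n). eigval_desc A j) + 2 * sqrt (real CARD('l)) * norm (B - A)"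
proof -
  have UU: "transpose U ** U = mat 1" using U by (simp add: leading_eigenvectors_def)
  obtain V :: "real^'l^'n" where V: "leading_eigenvectors A V"
    using leading_eigenvectors_exist[OF A card_le_of_orthonormal_columns[OF UU]] .
  then have VV: "transpose V ** V = mat 1" by (simp add: leading_eigenvectors_def)
  let ?P = "U ** transpose U" and ?Q = "V ** transpose V"
  have "?Q \<bullet> B \<le> ?P \<bullet> B"
    using inner_projection_le_sum_eigval_desc[OF B VV] inner_leading_projection[OF U] by simp
  \<comment> \<open>Adding the nonnegative number \<open>?P \<bullet> B - ?Q \<bullet> B\<close> to
    the left side gives exactly the right side.\<close>
  then have "(mat 1 - ?P) \<bullet> A - (mat 1 - ?Q) \<bullet> A \<le> (?P - ?Q) \<bullet> (B - A)"
    by (simp add: inner_diff_left inner_diff_right)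
  also have "\<dots> \<le> norm (?P - ?Q) * norm (B - A)"
    by (rule norm_cauchy_schwarz)
  also have "\<dots> \<le> (norm ?P + norm ?Q) * norm (B - A)"
    by (intro mult_right_mono norm_triangle_ineq4 norm_ge_zero)
  finally show ?thesis
    unfolding inner_complement_leading_projection[OF A V] norm_projection[OF UU] norm_projection[OF VV]
    by simp
qed

text \<open>The complement of the leading projection of \<open>B\<close> is a competitor in the
  minimization that defines the tail of \<open>A\<close>. Exchanging \<open>A\<close> for
  \<open>B\<close> costs its norm times that of \<open>B - A\<close>.\<close>

lemma sum_trailing_eigval_desc_perturbation:
  fixes A B :: "real^'n^'n" and U :: "real^'l^'n"
  assumes A: "transpose A = A" and B: "transpose B = B" and U: "leading_eigenvectors B U"
  shows "(\<Sum>j=CARD('l)+1..CARD('n). eigval_desc A j)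
    \<le> (\<Sum>j=CARD('l)+1..CARD('n). eigval_desc B j)
        + sqrt (real CARD('n) - real CARD('l)) * norm (B - A)"
proof -
  have UU: "transpose U ** U = mat 1" using U by (simp add: leading_eigenvectors_def)
  let ?R = "mat 1 - U ** transpose U"
  have "?R \<bullet> A = ?R \<bullet> B + ?R \<bullet> (A - B)" by (simp add: inner_diff_right)
  also have "\<dots> \<le> ?R \<bullet> B + norm ?R * norm (A - B)"
    by (intro add_left_mono norm_cauchy_schwarz)
  finally show ?thesis
    using sum_trailing_eigval_desc_le[OF A UU]
    unfolding inner_complement_leading_projection[OF B U] norm_complement_projection[OF UU]
    by (simp add: norm_minus_commute)
qed

section \<open>Sampling error of the second moment matrix\<close>

lemma (in prob_space) indep_vars_imp_indep_var:
  assumes "indep_vars (\<lambda>_. N) X I" and "i \<in> I" "j \<in> I" "i \<noteq> j"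
  shows "indep_var N (X i) N (X j)"
proof -
  have "indep_var (PiM {i} (\<lambda>_. N)) (\<lambda>\<omega>. \<lambda>i\<in>{i}. X i \<omega>) (PiM {j} (\<lambda>_. N)) (\<lambda>\<omega>. \<lambda>i\<in>{j}. X i \<omega>)"
    using assms by (intro indep_var_restrict) auto
  from indep_var_compose[OF this, of "\<lambda>f. f i" N "\<lambda>f. f j" N] show ?thesis
    by (simp add: comp_def)
qed

text \<open>Bienayme's identity: the square of the centred sum expands into a double sum whose
  off-diagonal terms have mean 0. Integrability is claimed separately because a non-integrable
  function would have integral 0.\<close>

lemma (in prob_space) variance_sum_indep:
  fixes X :: "'i \<Rightarrow> 'a \<Rightarrow> real"
  assumes ind: "indep_vars (\<lambda>_. borel) X I" and fin: "finite I"
    and sq: "\<And>i. i \<in> I \<Longrightarrow> integrable M (\<lambda>\<omega>. (X i \<omega>)\<^sup>2)"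
  shows "variance (\<lambda>\<omega>. \<Sum>i\<in>I. X i \<omega>) = (\<Sum>i\<in>I. variance (X i))"
    and "integrable M (\<lambda>\<omega>. ((\<Sum>i\<in>I. X i \<omega>) - expectation (\<lambda>\<omega>. \<Sum>i\<in>I. X i \<omega>))\<^sup>2)"
proof -
  define Z where "Z i \<omega> = X i \<omega> - expectation (X i)" for i \<omega>
  have meas: "random_variable borel (X i)" if "i \<in> I" for i
    using ind that by (auto simp: indep_vars_def)
  have int: "integrable M (X i)" if "i \<in> I" for i
    using square_integrable_imp_integrable[OF meas[OF that] sq[OF that]] .
  have Zint: "integrable M (Z i)" and Z0: "expectation (Z i) = 0" if "i \<in> I" for i
    unfolding Z_def using int[OF that] by (auto simp: prob_space)
  have Zsq: "integrable M (\<lambda>\<omega>. Z i \<omega> * Z i \<omega>)" if "i \<in> I" for i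
    using int[OF that] sq[OF that] by (simp add: Z_def algebra_simps power2_eq_square)
  have Zind: "indep_vars (\<lambda>_. borel) Z I"
    unfolding Z_def
    by (rule indep_vars_compose2[OF ind, of "\<lambda>i x. x - expectation (X i)"]) measurable
  have prod: "integrable M (\<lambda>\<omega>. Z i \<omega> * Z j \<omega>)"
    "expectation (\<lambda>\<omega>. Z i \<omega> * Z j \<omega>) = (if i = j then variance (X i) else 0)"
    if "i \<in> I" "j \<in> I" for i j
  proof -
    have "indep_var borel (Z i) borel (Z j)" if "i \<noteq> j"
      using indep_vars_imp_indep_var[OF Zind] that \<open>i \<in> I\<close> \<open>j \<in> I\<close> by blast
    then show "integrable M (\<lambda>\<omega>. Z i \<omega> * Z j \<omega>)"
      using indep_var_integrable Zint Zsq that by (cases "i = j") auto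
    show "expectation (\<lambda>\<omega>. Z i \<omega> * Z j \<omega>) = (if i = j then variance (X i) else 0)"
    proof (cases "i = j")
      case True
      then show ?thesis by (simp add: Z_def power2_eq_square)
    next
      case False
      then show ?thesis
        using indep_vars_imp_indep_var[OF Zind, of i j] indep_var_lebesgue_integral[of "Z i" "Z j"]
          Zint Z0 that by simp
    qed
  qed
  have eq: "((\<Sum>i\<in>I. X i \<omega>) - expectation (\<lambda>\<omega>. \<Sum>i\<in>I. X i \<omega>))\<^sup>2
      = (\<Sum>i\<in>I. \<Sum>j\<in>I. Z i \<omega> * Z j \<omega>)" for \<omega>
    using int by (simp add: Z_def sum_subtractf[symmetric] power2_eq_square sum_product[symmetric])
  show "integrable M (\<lambda>\<omega>. ((\<Sum>i\<in>I. X i \<omega>) - expectation (\<lambda>\<omega>. \<Sum>i\<in>I. X i \<omega>))\<^sup>2)"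
    unfolding eq using prod(1) by (intro Bochner_Integration.integrable_sum)
  show "variance (\<lambda>\<omega>. \<Sum>i\<in>I. X i \<omega>) = (\<Sum>i\<in>I. variance (X i))"
    unfolding eq using prod fin by (simp add: Bochner_Integration.integral_sum integrable_sum)
qed

text \<open>Coordinates reduce this to products of independent real variables, for which
  independence also yields integrability.\<close>

lemma (in prob_space) indep_var_expectation_inner:
  fixes Q Z :: "'a \<Rightarrow> 'b::euclidean_space"
  assumes ind: "indep_var borel Q borel Z" and Q: "integrable M Q" and Z: "integrable M Z"
  shows "integrable M (\<lambda>\<omega>. Q \<omega> \<bullet> Z \<omega>)"
    and "expectation (\<lambda>\<omega>. Q \<omega> \<bullet> Z \<omega>) = expectation Q \<bullet> expectation Z"
proof -
  have ind_b: "indep_var borel (\<lambda>\<omega>. Q \<omega> \<bullet> b) borel (\<lambda>\<omega>. Z \<omega> \<bullet> b)" for b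
    using indep_var_compose[OF ind, of "\<lambda>x. x \<bullet> b" borel "\<lambda>x. x \<bullet> b" borel] by (simp add: comp_def)
  have int: "integrable M (\<lambda>\<omega>. (Q \<omega> \<bullet> b) * (Z \<omega> \<bullet> b))" for b
    using Q Z by (intro indep_var_integrable[OF ind_b]) auto
  have E: "expectation (\<lambda>\<omega>. (Q \<omega> \<bullet> b) * (Z \<omega> \<bullet> b)) = (expectation Q \<bullet> b) * (expectation Z \<bullet> b)" for b
    using Q Z by (subst indep_var_lebesgue_integral[OF ind_b]) auto
  have eq: "Q \<omega> \<bullet> Z \<omega> = (\<Sum>b\<in>Basis. (Q \<omega> \<bullet> b) * (Z \<omega> \<bullet> b))" for \<omega>
    by (rule euclidean_inner)
  show "integrable M (\<lambda>\<omega>. Q \<omega> \<bullet> Z \<omega>)"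
    unfolding eq by (intro Bochner_Integration.integrable_sum int)
  have "expectation (\<lambda>\<omega>. Q \<omega> \<bullet> Z \<omega>) = (\<Sum>b\<in>Basis. (expectation Q \<bullet> b) * (expectation Z \<bullet> b))"
    unfolding eq by (simp add: Bochner_Integration.integral_sum int E)
  then show "expectation (\<lambda>\<omega>. Q \<omega> \<bullet> Z \<omega>) = expectation Q \<bullet> expectation Z"
    by (simp add: euclidean_inner[symmetric])
qed

text \<open>Nonnegativity of the variance.\<close>

lemma (in prob_space) expectation_le_sqrt_expectation_power2:
  fixes Z :: "'a \<Rightarrow> real"
  assumes "random_variable borel Z" and "integrable M (\<lambda>\<omega>. (Z \<omega>)\<^sup>2)"
  shows "expectation Z \<le> sqrt (expectation (\<lambda>\<omega>. (Z \<omega>)\<^sup>2))"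
proof (rule real_le_rsqrt)
  have "integrable M Z" using square_integrable_imp_integrable[OF assms] .
  then show "(expectation Z)\<^sup>2 \<le> expectation (\<lambda>\<omega>. (Z \<omega>)\<^sup>2)"
    using variance_positive[of Z] by (simp add: variance_eq assms)
qed

section \<open>Integrals of matrix-valued functions, entry by entry\<close>

lemma outer_nth: "outer v $ j $ k = v $ j * v $ k"
  by (simp add: outer_def)

lemma continuous_on_outer: "continuous_on S (outer :: real^'n \<Rightarrow> _)"
  unfolding outer_def by (intro continuous_intros)

lemma borel_measurable_outer [measurable]: "(outer :: real^'n \<Rightarrow> _) \<in> borel_measurable borel"
  by (intro borel_measurable_continuous_onI continuous_on_outer)

lemma power2_norm_matrix:
  fixes A :: "real^'n^'m"
  shows "(norm A)\<^sup>2 = (\<Sum>j\<in>UNIV. \<Sum>k\<in>UNIV. (A $ j $ k)\<^sup>2)"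
  unfolding power2_norm_eq_inner by (simp add: inner_vec_def power2_eq_square)

text \<open>Entries may lie in any Euclidean space, so that two applications handle
  matrices.\<close>

lemma integrable_vec_componentwise:
  fixes F :: "'a \<Rightarrow> ('b::euclidean_space)^'n"
  assumes "\<And>i. integrable M (\<lambda>\<omega>. F \<omega> $ i)"
  shows "integrable M F"
proof -
  have "F = (\<lambda>\<omega>. \<Sum>i\<in>UNIV. axis i (F \<omega> $ i))"
    by (simp add: fun_eq_iff vec_eq_iff axis_def)
  moreover have "bounded_linear (axis i :: 'b \<Rightarrow> 'b^'n)" for i
    by (intro linear_conv_bounded_linear[THEN iffD1] linearI) (auto simp: axis_def vec_eq_iff)
  then have "integrable M (\<lambda>\<omega>. \<Sum>i\<in>UNIV. axis i (F \<omega> $ i))"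
    by (intro Bochner_Integration.integrable_sum integrable_bounded_linear[OF _ assms])
  ultimately show ?thesis by metis
qed

lemma integral_vec_nth:
  fixes F :: "'a \<Rightarrow> ('b::euclidean_space)^'n"
  assumes "integrable M F"
  shows "(\<integral>\<omega>. F \<omega> \<partial>M) $ i = (\<integral>\<omega>. F \<omega> $ i \<partial>M)"
  by (rule integral_bounded_linear[OF bounded_linear_vec_nth assms, symmetric])

lemma integral_outer_nth:
  fixes X :: "'a \<Rightarrow> real^'n"
  assumes "integrable M (\<lambda>\<omega>. outer (X \<omega>))"
  shows "(\<integral>\<omega>. outer (X \<omega>) \<partial>M) $ j $ k = (\<integral>\<omega>. X \<omega> $ j * X \<omega> $ k \<partial>M)"
proof -
  have "integrable M (\<lambda>\<omega>. outer (X \<omega>) $ j)"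
    by (rule integrable_bounded_linear[OF bounded_linear_vec_nth assms])
  then show ?thesis
    using assms by (simp add: integral_vec_nth outer_nth)
qed

text \<open>Each entry of \<open>D\<close> is a centred mean of \<open>N\<close> independent terms
  of variance at most \<open>C\<^sup>2\<close>, so its second moment is at most
  \<open>C\<^sup>2 / N\<close>. Summing over all entries and taking the root bounds the mean
  Frobenius norm.\<close>

lemma (in prob_space) sample_second_moment_error:
  fixes Y :: "nat \<Rightarrow> 'a \<Rightarrow> real^'n"
  assumes N: "N \<ge> 1"
    and ind: "indep_vars (\<lambda>_. borel) Y {0..N}"
    and ident: "\<And>i. i \<le> N \<Longrightarrow> distr M borel (Y i) = distr M borel (Y 0)"
    and sq: "\<And>j k. integrable M (\<lambda>\<omega>. (Y 0 \<omega> $ j * Y 0 \<omega> $ k)\<^sup>2)"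
    and var: "\<And>j k. sqrt (variance (\<lambda>\<omega>. Y 0 \<omega> $ j * Y 0 \<omega> $ k)) \<le> C"
  defines "D \<equiv> \<lambda>\<omega>. (1 / real N) *\<^sub>R (\<Sum>i=1..N. outer (Y i \<omega>)) - expectation (\<lambda>\<omega>. outer (Y 0 \<omega>))"
  shows "integrable M (\<lambda>\<omega>. norm (D \<omega>))"
    and "expectation (\<lambda>\<omega>. norm (D \<omega>)) \<le> real CARD('n) * (C / sqrt (real N))"
proof -
  have Y[measurable]: "random_variable borel (Y i)" if "i \<le> N" for i
    using ind that by (auto simp: indep_vars_def)
  have C: "0 \<le> C" using var[of undefined undefined] variance_positive by (meson order_trans real_sqrt_ge_zero)
  define g where "g j k v = v $ j * v $ k" for j k and v :: "real^'n"
  have g[measurable]: "g j k \<in> borel_measurable borel" for j k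
    unfolding g_def by measurable
  \<comment> \<open>The samples share only their law with \<open>Y 0\<close>, so integrals are moved
    through the image measure.\<close>
  have transfer: "integrable M (\<lambda>\<omega>. h (Y i \<omega>)) = integrable M (\<lambda>\<omega>. h (Y 0 \<omega>))"
    "expectation (\<lambda>\<omega>. h (Y i \<omega>)) = expectation (\<lambda>\<omega>. h (Y 0 \<omega>))"
    if "i \<le> N" and h: "h \<in> borel_measurable borel" for h :: "real^'n \<Rightarrow> real" and i
    using integrable_distr_eq[OF Y[OF that(1)] h] integrable_distr_eq[OF Y[of 0] h]
      integral_distr[OF Y[OF that(1)] h] integral_distr[OF Y[of 0] h] ident[OF that(1)]
    by simp_all
  have gsq: "integrable M (\<lambda>\<omega>. (g j k (Y i \<omega>))\<^sup>2)" if "i \<le> N" for i j k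
    using transfer(1)[OF that, of "\<lambda>v. (g j k v)\<^sup>2"] sq[of j k] by (simp add: g_def)
  have gint: "integrable M (\<lambda>\<omega>. g j k (Y i \<omega>))" if "i \<le> N" for i j k
    by (rule square_integrable_imp_integrable[OF measurable_compose[OF Y[OF that] g] gsq[OF that]])
  have outer_int: "integrable M (\<lambda>\<omega>. outer (Y 0 \<omega>))"
    using gint[of 0] by (intro integrable_vec_componentwise) (simp add: outer_def g_def)
  define m where "m j k = expectation (\<lambda>\<omega>. g j k (Y 0 \<omega>))" for j k
  have m: "expectation (\<lambda>\<omega>. outer (Y 0 \<omega>)) $ j $ k = m j k" for j k
    using integral_outer_nth[OF outer_int] by (simp add: m_def g_def)
  have Dnth: "D \<omega> $ j $ k = (\<Sum>i=1..N. g j k (Y i \<omega>)) / real N - m j k" for \<omega> j k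
    by (simp add: D_def m outer_nth g_def)
  have entry: "integrable M (\<lambda>\<omega>. (D \<omega> $ j $ k)\<^sup>2)"
    "expectation (\<lambda>\<omega>. (D \<omega> $ j $ k)\<^sup>2) \<le> C\<^sup>2 / real N" for j k
  proof -
    let ?X = "\<lambda>i \<omega>. g j k (Y i \<omega>)"
    have indX: "indep_vars (\<lambda>_. borel) ?X {1..N}"
      by (rule indep_vars_compose2[OF indep_vars_subset[OF ind]]) auto
    have mean: "expectation (?X i) = m j k" if "i \<le> N" for i
      using transfer(2)[OF that g] by (simp add: m_def)
    have sum: "expectation (\<lambda>\<omega>. \<Sum>i=1..N. ?X i \<omega>) = real N * m j k"
      using gint mean by (simp add: Bochner_Integration.integral_sum)
    have eq: "(D \<omega> $ j $ k)\<^sup>2 = ((\<Sum>i=1..N. ?X i \<omega>) - expectation (\<lambda>\<omega>. \<Sum>i=1..N. ?X i \<omega>))\<^sup>2 / (real N)\<^sup>2" for \<omega>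
      unfolding sum Dnth using N by (simp add: field_simps flip: power_divide)
    have X2: "integrable M (\<lambda>\<omega>. (?X i \<omega>)\<^sup>2)" if "i \<in> {1..N}" for i
      using that by (intro gsq) auto
    show "integrable M (\<lambda>\<omega>. (D \<omega> $ j $ k)\<^sup>2)"
      unfolding eq using variance_sum_indep(2)[OF indX _ X2] by simp
    have varX: "variance (?X i) \<le> C\<^sup>2" if "i \<in> {1..N}" for i
    proof -
      have "variance (?X i) = variance (?X 0)"
        using that transfer(2)[of i "\<lambda>v. (g j k v - m j k)\<^sup>2"] mean[of i] mean[of 0] by simp
      also have "\<dots> \<le> C\<^sup>2"
        using var[of j k] sqrt_le_D by (auto simp: g_def)
      finally show ?thesis .
    qed
    have "expectation (\<lambda>\<omega>. (D \<omega> $ j $ k)\<^sup>2) = (\<Sum>i=1..N. variance (?X i)) / (real N)\<^sup>2"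
      unfolding eq using variance_sum_indep(1)[OF indX _ X2] by simp
    also have "\<dots> \<le> (\<Sum>i=1..N. C\<^sup>2) / (real N)\<^sup>2"
      using varX by (intro divide_right_mono sum_mono) auto
    also have "\<dots> = C\<^sup>2 / real N"
      using N by (simp add: power2_eq_square)
    finally show "expectation (\<lambda>\<omega>. (D \<omega> $ j $ k)\<^sup>2) \<le> C\<^sup>2 / real N" .
  qed
  have Dmeas: "random_variable borel D"
    unfolding D_def by measurable
  have normsq: "integrable M (\<lambda>\<omega>. (norm (D \<omega>))\<^sup>2)"
    unfolding power2_norm_matrix by (intro Bochner_Integration.integrable_sum entry)
  show "integrable M (\<lambda>\<omega>. norm (D \<omega>))"
    by (rule square_integrable_imp_integrable[OF _ normsq]) (use Dmeas in measurable)
  have "expectation (\<lambda>\<omega>. (norm (D \<omega>))\<^sup>2) = (\<Sum>j\<in>UNIV. \<Sum>k\<in>UNIV. expectation (\<lambda>\<omega>. (D \<omega> $ j $ k)\<^sup>2))"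
    unfolding power2_norm_matrix
    by (simp add: Bochner_Integration.integral_sum Bochner_Integration.integrable_sum entry)
  also have "\<dots> \<le> (\<Sum>j\<in>(UNIV::'n set). \<Sum>k\<in>(UNIV::'n set). C\<^sup>2 / real N)"
    by (intro sum_mono entry)
  also have "\<dots> = (real CARD('n) * (C / sqrt (real N)))\<^sup>2"
    by (simp add: power_mult_distrib power_divide power2_eq_square)
  finally have "sqrt (expectation (\<lambda>\<omega>. (norm (D \<omega>))\<^sup>2)) \<le> real CARD('n) * (C / sqrt (real N))"
    using C by (intro real_le_lsqrt) auto
  moreover have "expectation (\<lambda>\<omega>. norm (D \<omega>)) \<le> sqrt (expectation (\<lambda>\<omega>. (norm (D \<omega>))\<^sup>2))"
    by (rule expectation_le_sqrt_expectation_power2[OF _ normsq]) (use Dmeas in measurable)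
  ultimately show "expectation (\<lambda>\<omega>. norm (D \<omega>)) \<le> real CARD('n) * (C / sqrt (real N))"
    by linarith
qed

section \<open>Expected projection error\<close>

text \<open>Weakens the factors \<open>sqrt l\<close> and \<open>sqrt (d - l)\<close> of the
  perturbation bounds to \<open>l\<close> and \<open>d - l\<close>. Integrality matters: the
  inequality fails strictly between 0 and 1.\<close>

lemma sqrt_of_nat_le_self: "sqrt (real k) \<le> real k"
proof (rule real_le_lsqrt)
  show "real k \<le> (real k)\<^sup>2"
    by (cases k) (simp_all add: power2_eq_square)
qed simp_all

text \<open>Index 0 is the fresh draw and 1 to \<open>N\<close> are the samples. Writing
  \<open>U\<close> as a measurable function \<open>\<Phi>\<close> of the samples makes the
  projection independent of \<open>Y 0\<close>. The eigenvalues of \<open>G\<close> are random, so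
  their sum enters the last bound in expectation.\<close>

theorem proposition1:
  fixes T C :: real and N :: nat
    and f :: "real^'d \<Rightarrow> real^'m \<Rightarrow> real^'p \<Rightarrow> real^'d"
    and x :: "real^'p \<Rightarrow> real^'d"
    and L :: "real^'d \<Rightarrow> real^'m \<Rightarrow> real"
    and Uad :: "(real^'m) set"
    and y :: "real \<Rightarrow> real^'p \<Rightarrow> real^'d"
    and \<pi> :: "real \<Rightarrow> real"
    and M :: "'w measure"
    and t :: "nat \<Rightarrow> 'w \<Rightarrow> real"
    and \<mu> :: "nat \<Rightarrow> 'w \<Rightarrow> real^'p"
    and \<Phi> :: "(nat \<Rightarrow> real^'d) \<Rightarrow> real^'l^'d"
  defines "Y \<equiv> \<lambda>i \<omega>. y (t i \<omega>) (\<mu> i \<omega>)"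
  defines "G \<equiv> \<lambda>\<omega>. (1 / real N) *\<^sub>R (\<Sum>i=1..N. outer (Y i \<omega>))"
    and "Gstar \<equiv> prob_space.expectation M (\<lambda>\<omega>. outer (Y 0 \<omega>))"
    and "U \<equiv> \<lambda>\<omega>. \<Phi> (\<lambda>i\<in>{1..N}. Y i \<omega>)"
  assumes "T > 0" and "N \<ge> 1"
    and optimal: "\<And>m. optimal_trajectory T f x L Uad m (\<lambda>s. y s m)"
    and prob: "prob_space M"
    and density: "\<pi> \<in> borel_measurable borel" "\<And>s. 0 \<le> \<pi> s"
    and t_uniform: "\<And>i. i \<le> N \<Longrightarrow>
          distributed M lborel (t i) (\<lambda>s. indicator {0..T} s / measure lborel {0..T})"
    and \<mu>_density: "\<And>i. i \<le> N \<Longrightarrow>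
          distributed M lborel (\<mu> i) (\<lambda>m. ennreal (\<Prod>k\<in>UNIV. \<pi> (m $ k)))"
    and indep: "prob_space.indep_vars M (\<lambda>_. borel) Y {0..N}"
    and ident: "\<And>i. i \<le> N \<Longrightarrow> distr M borel (Y i) = distr M borel (Y 0)"
    and var_finite: "\<And>j k. integrable M (\<lambda>\<omega>. (Y 0 \<omega> $ j * Y 0 \<omega> $ k)\<^sup>2)"
    and var_bound: "\<And>j k. sqrt (prob_space.variance M (\<lambda>\<omega>. Y 0 \<omega> $ j * Y 0 \<omega> $ k)) \<le> C"
    and \<Phi>_measurable: "\<Phi> \<in> borel_measurable (\<Pi>\<^sub>M i\<in>{1..N}. borel)"
    and leading: "\<And>\<omega>. \<omega> \<in> space M \<Longrightarrow> leading_eigenvectors (G \<omega>) (U \<omega>)"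
  shows "prob_space.expectation M
           (\<lambda>\<omega>. (norm (Y 0 \<omega> - (U \<omega> ** transpose (U \<omega>)) *v Y 0 \<omega>))\<^sup>2)
         \<le> (\<Sum>j=CARD('l)+1..CARD('d). eigval_desc Gstar j)
           + 2 * real CARD('d) * real CARD('l) * (C / sqrt (real N))
       \<and> (\<Sum>j=CARD('l)+1..CARD('d). eigval_desc Gstar j)
           + 2 * real CARD('d) * real CARD('l) * (C / sqrt (real N))
         \<le> prob_space.expectation M (\<lambda>\<omega>. \<Sum>j=CARD('l)+1..CARD('d). eigval_desc (G \<omega>) j)
           + (real CARD('d) + real CARD('l)) * real CARD('d) * (C / sqrt (real N))"
proof -
  interpret prob_space M by (rule prob)
  let ?n = "CARD('d)" and ?l = "CARD('l)"
  let ?\<epsilon> = "C / sqrt (real N)"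
  let ?P = "\<lambda>\<omega>. U \<omega> ** transpose (U \<omega>)"
  let ?R = "\<lambda>\<omega>. mat 1 - ?P \<omega>"
  let ?S = "\<lambda>A :: real^'d^'d. \<Sum>j=?l+1..?n. eigval_desc A j"
  have Y[measurable]: "random_variable borel (Y i)" if "i \<le> N" for i
    using indep that by (auto simp: indep_vars_def)
  have UU: "transpose (U \<omega>) ** U \<omega> = mat 1" if "\<omega> \<in> space M" for \<omega>
    using leading[OF that] by (simp add: leading_eigenvectors_def)
  obtain \<omega>0 where "\<omega>0 \<in> space M" using not_empty by blast
  then have ln: "?l \<le> ?n" using card_le_of_orthonormal_columns[OF UU] by blast
  have err: "integrable M (\<lambda>\<omega>. norm (G \<omega> - Gstar))"
    "expectation (\<lambda>\<omega>. norm (G \<omega> - Gstar)) \<le> real ?n * ?\<epsilon>"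
    unfolding G_def Gstar_def
    using sample_second_moment_error[OF \<open>N \<ge> 1\<close> indep ident var_finite var_bound] by auto
  \<comment> \<open>The sign follows from the error estimate, whose left side is a mean of
    norms.\<close>
  have \<epsilon>: "0 \<le> real ?n * ?\<epsilon>"
    using err(2) by (rule order_trans[rotated]) (simp add: integral_nonneg_AE)

  have outer_int: "integrable M (\<lambda>\<omega>. outer (Y 0 \<omega>))"
  proof (intro integrable_vec_componentwise)
    fix j k
    have "(\<lambda>v :: real^'d. v $ j * v $ k) \<in> borel_measurable borel" by measurable
    from measurable_compose[OF Y[of 0] this]
    have "(\<lambda>\<omega>. Y 0 \<omega> $ j * Y 0 \<omega> $ k) \<in> borel_measurable M" by simp
    from square_integrable_imp_integrable[OF this var_finite]
    show "integrable M (\<lambda>\<omega>. outer (Y 0 \<omega>) $ j $ k)" by (simp add: outer_nth)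
  qed
  have Gstar_sym: "transpose Gstar = Gstar"
    unfolding Gstar_def
    by (simp add: vec_eq_iff transpose_def integral_outer_nth[OF outer_int] mult.commute)
  have G_sym: "transpose (G \<omega>) = G \<omega>" for \<omega>
    by (simp add: G_def vec_eq_iff transpose_def outer_nth mult.commute)

  \<comment> \<open>Measurability, integrability and independence of the complementary
    projection\<close>
  have R_meas: "(\<lambda>z. mat 1 - \<Phi> z ** transpose (\<Phi> z)) \<in> borel_measurable (\<Pi>\<^sub>M i\<in>{1..N}. borel)"
  proof -
    have "continuous_on UNIV (\<lambda>V :: real^'l^'d. mat 1 - V ** transpose V)"
      unfolding matrix_matrix_mult_def transpose_def by (intro continuous_intros)
    then have "(\<lambda>V :: real^'l^'d. mat 1 - V ** transpose V) \<in> borel_measurable borel"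
      by (rule borel_measurable_continuous_onI)
    then show ?thesis by (rule measurable_compose[OF \<Phi>_measurable])
  qed
  have sample: "(\<lambda>\<omega>. \<lambda>i\<in>{1..N}. Y i \<omega>) \<in> measurable M (\<Pi>\<^sub>M i\<in>{1..N}. borel)"
    by (rule measurable_restrict) (auto intro: Y)
  have R_rv: "random_variable borel ?R"
    unfolding U_def by (rule measurable_compose[OF sample R_meas])
  \<comment> \<open>The norm of \<open>?R\<close> is constant on the space, so \<open>?R\<close> is
    bounded.\<close>
  have R_int: "integrable M ?R"
    using norm_complement_projection[OF UU]
    by (intro integrable_const_bound[OF _ R_rv, of "sqrt (real ?n - real ?l)"]) auto
  have indep_RY: "indep_var borel ?R borel (\<lambda>\<omega>. outer (Y 0 \<omega>))"
  proof -
    have "indep_var (\<Pi>\<^sub>M i\<in>{1..N}. borel) (\<lambda>\<omega>. \<lambda>i\<in>{1..N}. Y i \<omega>)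
        (\<Pi>\<^sub>M i\<in>{0}. borel) (\<lambda>\<omega>. \<lambda>i\<in>{0}. Y i \<omega>)"
      by (rule indep_var_restrict[OF indep]) auto
    moreover note R_meas
    moreover have "(\<lambda>z. outer (z 0)) \<in> borel_measurable (\<Pi>\<^sub>M i\<in>{0::nat}. borel :: (real^'d) measure)"
      by measurable
    ultimately have "indep_var borel ((\<lambda>z. mat 1 - \<Phi> z ** transpose (\<Phi> z)) \<circ> (\<lambda>\<omega>. \<lambda>i\<in>{1..N}. Y i \<omega>))
        borel ((\<lambda>z. outer (z 0)) \<circ> (\<lambda>\<omega>. \<lambda>i\<in>{0}. Y i \<omega>))"
      by (rule indep_var_compose)
    then show ?thesis by (simp add: U_def comp_def)
  qed

  have trailing: "?S (G \<omega>) = ?R \<omega> \<bullet> G \<omega>" if "\<omega> \<in> space M" for \<omega>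
    using inner_complement_leading_projection[OF G_sym leading[OF that]] by simp
  have RG_int: "integrable M (\<lambda>\<omega>. ?R \<omega> \<bullet> Gstar)"
    using R_int by simp
  \<comment> \<open>The eigenvalue tail is treated as the pairing of \<open>?R\<close> with
    \<open>G\<close>, whose measurability is clear. Splitting off \<open>Gstar\<close> leaves a term
    dominated by a multiple of the integrable sampling error.\<close>
  have S_int: "integrable M (\<lambda>\<omega>. ?S (G \<omega>))"
  proof -
    have "(\<lambda>\<omega>. ?R \<omega> \<bullet> G \<omega>) \<in> borel_measurable M"
      unfolding G_def by (intro borel_measurable_inner R_rv) measurable
    then have "(\<lambda>\<omega>. ?R \<omega> \<bullet> (G \<omega> - Gstar)) \<in> borel_measurable M"
      using RG_int by (simp add: inner_diff_right)
    moreover have "AE \<omega> in M. norm (?R \<omega> \<bullet> (G \<omega> - Gstar))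
        \<le> norm (sqrt (real ?n - real ?l) * norm (G \<omega> - Gstar))"
    proof (rule AE_I2)
      fix \<omega> assume "\<omega> \<in> space M"
      have "\<bar>?R \<omega> \<bullet> (G \<omega> - Gstar)\<bar> \<le> norm (?R \<omega>) * norm (G \<omega> - Gstar)"
        by (rule Cauchy_Schwarz_ineq2)
      then show "norm (?R \<omega> \<bullet> (G \<omega> - Gstar)) \<le> norm (sqrt (real ?n - real ?l) * norm (G \<omega> - Gstar))"
        unfolding norm_complement_projection[OF UU[OF \<open>\<omega> \<in> space M\<close>]] by simp
    qed
    ultimately have "integrable M (\<lambda>\<omega>. ?R \<omega> \<bullet> (G \<omega> - Gstar))"
      by (intro Bochner_Integration.integrable_bound[OF integrable_mult_right[OF err(1)]])
    then have "integrable M (\<lambda>\<omega>. ?R \<omega> \<bullet> (G \<omega> - Gstar) + ?R \<omega> \<bullet> Gstar)"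
      using RG_int by (rule Bochner_Integration.integrable_add)
    then have "integrable M (\<lambda>\<omega>. ?R \<omega> \<bullet> G \<omega>)"
      by (simp add: inner_diff_right)
    then show ?thesis
      using trailing by (simp cong: Bochner_Integration.integrable_cong)
  qed

  \<comment> \<open>Expected projection error against the tail of \<open>Gstar\<close>\<close>
  have "expectation (\<lambda>\<omega>. (norm (Y 0 \<omega> - ?P \<omega> *v Y 0 \<omega>))\<^sup>2)
      = expectation (\<lambda>\<omega>. ?R \<omega> \<bullet> outer (Y 0 \<omega>))"
    using norm_diff_projection[OF UU] by (intro Bochner_Integration.integral_cong) auto
  also have "\<dots> = expectation ?R \<bullet> Gstar"
    unfolding Gstar_def by (rule indep_var_expectation_inner(2)[OF indep_RY R_int outer_int])
  \<comment> \<open>With \<open>Gstar\<close> constant, the expectation moves back outside, so that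
    the perturbation bound can be used pointwise.\<close>
  also have "\<dots> = expectation (\<lambda>\<omega>. ?R \<omega> \<bullet> Gstar)"
    using R_int by simp
  also have "\<dots> \<le> expectation (\<lambda>\<omega>. ?S Gstar + 2 * sqrt (real ?l) * norm (G \<omega> - Gstar))"
    using RG_int err(1) leading_projection_perturbation[OF Gstar_sym G_sym leading]
    by (intro integral_mono) auto
  also have "\<dots> = ?S Gstar + 2 * sqrt (real ?l) * expectation (\<lambda>\<omega>. norm (G \<omega> - Gstar))"
    using err(1) by (simp add: prob_space)
  also have "\<dots> \<le> ?S Gstar + 2 * sqrt (real ?l) * (real ?n * ?\<epsilon>)"
    using err(2) by (intro add_left_mono mult_left_mono) auto
  also have "\<dots> \<le> ?S Gstar + 2 * real ?l * (real ?n * ?\<epsilon>)"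
    using sqrt_of_nat_le_self[of ?l] \<epsilon> by (intro add_left_mono mult_right_mono) auto
  finally have first: "expectation (\<lambda>\<omega>. (norm (Y 0 \<omega> - ?P \<omega> *v Y 0 \<omega>))\<^sup>2)
      \<le> ?S Gstar + 2 * real ?n * real ?l * ?\<epsilon>"
    by (simp add: mult_ac)

  \<comment> \<open>Tail of \<open>Gstar\<close> against the expected tail of
    \<open>G\<close>\<close>
  have "?S Gstar = expectation (\<lambda>\<omega>. ?S Gstar)"
    by (simp add: prob_space)
  also have "\<dots> \<le> expectation (\<lambda>\<omega>. ?S (G \<omega>) + sqrt (real ?n - real ?l) * norm (G \<omega> - Gstar))"
    using S_int err(1) sum_trailing_eigval_desc_perturbation[OF Gstar_sym G_sym leading]
    by (intro integral_mono) auto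
  also have "\<dots> = expectation (\<lambda>\<omega>. ?S (G \<omega>))
      + sqrt (real ?n - real ?l) * expectation (\<lambda>\<omega>. norm (G \<omega> - Gstar))"
    using S_int err(1) by simp
  also have "\<dots> \<le> expectation (\<lambda>\<omega>. ?S (G \<omega>)) + sqrt (real (?n - ?l)) * (real ?n * ?\<epsilon>)"
    using err(2) ln by (intro add_left_mono mult_mono) (auto simp: of_nat_diff integral_nonneg_AE)
  also have "\<dots> \<le> expectation (\<lambda>\<omega>. ?S (G \<omega>)) + real (?n - ?l) * (real ?n * ?\<epsilon>)"
    using sqrt_of_nat_le_self[of "?n - ?l"] \<epsilon> by (intro add_left_mono mult_right_mono) auto
  finally have "?S Gstar \<le> expectation (\<lambda>\<omega>. ?S (G \<omega>)) + real (?n - ?l) * (real ?n * ?\<epsilon>)" .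
  \<comment> \<open>Adding the sampling term of the first bound turns the factor
    \<open>d - l\<close> into \<open>d + l\<close>; \<open>ln\<close> keeps the natural subtraction
    exact.\<close>
  moreover have "real (?n - ?l) * (real ?n * e) + 2 * real ?n * real ?l * e
      = (real ?n + real ?l) * real ?n * e" for e
    using ln by (simp add: of_nat_diff algebra_simps)
  from this[of ?\<epsilon>] calculation have "?S Gstar + 2 * real ?n * real ?l * ?\<epsilon>
      \<le> expectation (\<lambda>\<omega>. ?S (G \<omega>)) + (real ?n + real ?l) * real ?n * ?\<epsilon>"
    by linarith
  with first show ?thesis by blast
qed

end
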